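(* Let $q$ be an even prime power, let $\perp$ be a unitary polarity of the Desarguesian projective plane $\mathrm{PG}(2,q^2)$, and let $\mathrm{DUP}(q^2)$ be the corresponding unitary polarity graph. Then there exists a set of $q^4/2$ non-absolute points of $\mathrm{PG}(2,q^2)$ inducing a triangle-free subgraph of $\mathrm{DUP}(q^2)$.
   Context: A polarity $\perp$ is an involutory incidence-preserving bijection between points and lines; a point $x$ is absolute if $x \in x^\perp$. A unitary polarity of a plane of order $q^2$ is one with $q^3+1$ absolute points (in $\mathrm{PG}(2,q^2)$ these form a Hermitian curve). $\mathrm{DUP}(q^2)$ is the graph with vertex set the points of $\mathrm{PG}(2,q^2)$, where $x$ and $y$ are adjacent iff $x \in y^\perp$. A triangle is a set of three distinct pairwise adjacent vertices. *)

theory Defs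
  imports
    "HOL-Analysis.Cartesian_Space"
    "HOL-Number_Theory.Prime_Powers"
    "Graph_Theory.Digraph_Component"
    "Graph_Theory.Pair_Digraph"
begin

text \<open>
  The Desarguesian projective plane over a field, of order \<open>CARD('a)\<close> when the field is finite:
  points and lines are the one- and two-dimensional subspaces of the three-dimensional coordinate
  space, and incidence is inclusion.
\<close>

definition pg_points :: "('a::field ^ 3) set set" where
  "pg_points = {x. vec.subspace x \<and> vec.dim x = 1}"

definition pg_lines :: "('a::field ^ 3) set set" where
  "pg_lines = {l. vec.subspace l \<and> vec.dim l = 2}"

text \<open>
  Since points and lines are both sets of vectors, a single function acts on both kinds of
  elements; its values elsewhere are irrelevant.
\<close>

definition pg_polarity :: "(('a::field ^ 3) set \<Rightarrow> ('a ^ 3) set) \<Rightarrow> bool" where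
  "pg_polarity perp \<longleftrightarrow>
     bij_betw perp pg_points pg_lines \<and>
     bij_betw perp pg_lines pg_points \<and>
     (\<forall>u \<in> pg_points \<union> pg_lines. perp (perp u) = u) \<and>
     (\<forall>x \<in> pg_points. \<forall>l \<in> pg_lines. x \<subseteq> l \<longleftrightarrow> perp l \<subseteq> perp x)"

definition absolute_points :: "(('a::field ^ 3) set \<Rightarrow> ('a ^ 3) set) \<Rightarrow> ('a ^ 3) set set" where
  "absolute_points perp = {x \<in> pg_points. x \<subseteq> perp x}"

definition unitary_polarity ::
    "nat \<Rightarrow> (('a::{field,finite} ^ 3) set \<Rightarrow> ('a ^ 3) set) \<Rightarrow> bool" where
  "unitary_polarity q perp \<longleftrightarrow>
     CARD('a) = q ^ 2 \<and> pg_polarity perp \<and> card (absolute_points perp) = q ^ 3 + 1"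

text \<open>
  The polarity graph, as a digraph whose arc relation is symmetric whenever \<open>perp\<close> is a polarity.
  Absolute points carry loops, which play no role in triangles.
\<close>

definition polarity_graph ::
    "(('a::field ^ 3) set \<Rightarrow> ('a ^ 3) set) \<Rightarrow> ('a ^ 3) set pair_pre_digraph" where
  "polarity_graph perp =
     \<lparr>pverts = pg_points, parcs = {(x, y). x \<in> pg_points \<and> y \<in> pg_points \<and> x \<subseteq> perp y}\<rparr>"

lemma polarity_graph_symmetric:
  assumes "pg_polarity perp" "(x, y) \<in> parcs (polarity_graph perp)"
  shows "(y, x) \<in> parcs (polarity_graph perp)"
proof -
  have x: "x \<in> pg_points" and y: "y \<in> pg_points" and le: "x \<subseteq> perp y"
    using assms(2) by (auto simp: polarity_graph_def)
  have "perp y \<in> pg_lines"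
    using assms(1) y by (auto simp: pg_polarity_def bij_betw_def)
  then have "perp (perp y) \<subseteq> perp x"
    using assms(1) x le by (auto simp: pg_polarity_def)
  then show ?thesis
    using assms(1) x y by (simp add: pg_polarity_def polarity_graph_def)
qed

definition triangle_in :: "('v, 'e) pre_digraph \<Rightarrow> 'v set \<Rightarrow> bool" where
  "triangle_in G T \<longleftrightarrow>
     T \<subseteq> verts G \<and> card T = 3 \<and> (\<forall>x \<in> T. \<forall>y \<in> T. x \<noteq> y \<longrightarrow> x \<rightarrow>\<^bsub>G\<^esub> y)"

definition triangle_free :: "('v, 'e) pre_digraph \<Rightarrow> bool" where
  "triangle_free G \<longleftrightarrow> \<not> (\<exists>T. triangle_in G T)"

end

theory Submission
  imports Defs
begin

text \<open>
  Let \<open>a\<close>, \<open>b\<close> be distinct absolute points, let \<open>c\<close> be the intersection of their polars, and choose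
  vectors \<open>A\<close>, \<open>B\<close>, \<open>C\<close> spanning \<open>a\<close>, \<open>b\<close>, \<open>c\<close>. The points off the polar of \<open>a\<close> are
  \<open>p(s, t) = \<langle>s A + t C + B\<rangle>\<close>, and \<open>p(x, y)\<close> lies on the polar of \<open>p(s, t)\<close> iff
  \<open>x = \<beta>(t) y + \<alpha>(s)\<close>, because the polars of \<open>p(s, t)\<close> for fixed \<open>s\<close> (fixed \<open>t\<close>) are concurrent.
  After rescaling \<open>A\<close> so that \<open>\<beta>(1) = 1\<close>, symmetry of this relation in characteristic 2 forces
  \<open>\<alpha> = \<beta> = \<sigma>\<close> to be an automorphism with \<open>\<sigma>\<^sup>2 = 1\<close>, so the fundamental theorem of projective
  geometry is not needed. The number of absolute points excludes \<open>\<sigma> = 1\<close>, hence the fixed field \<open>F\<close>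
  of \<open>\<sigma>\<close> has order \<open>q\<close>.

  Put \<open>H(s, t) = s + \<sigma>(s) + t \<sigma>(t)\<close>. If three points \<open>p(s\<^sub>i, t\<^sub>i)\<close> are pairwise conjugate and
  not absolute, expanding \<open>A\<close> in the orthogonal basis of the corresponding vectors and comparing
  coefficients of \<open>B\<close> gives \<open>\<Sum> 1 / H(s\<^sub>i, t\<^sub>i) = 0\<close>. The additive subgroup
  \<open>W = {x\<^sup>2 + x | x \<in> F}\<close> has index 2 in \<open>F\<close>, so three elements outside \<open>W\<close> never sum to \<open>0\<close>.
  Thus the points with \<open>1 / H(s, t) \<notin> W\<close> contain no triangle, and there are
  \<open>q\<^sup>2 \<cdot> q \<cdot> q / 2\<close> of them: any \<open>t\<close>, then one of \<open>q / 2\<close> values of \<open>H\<close>, then \<open>q\<close> solutions \<open>s\<close>.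
\<close>

subsection \<open>Involutory automorphisms in characteristic 2\<close>

locale char2_involution =
  fixes \<sigma> :: "'a::field \<Rightarrow> 'a"
  assumes char2: "(2::'a) = 0"
    and add: "\<sigma> (x + y) = \<sigma> x + \<sigma> y"
    and mult: "\<sigma> (x * y) = \<sigma> x * \<sigma> y"
    and invol: "\<sigma> (\<sigma> x) = x"
begin

definition fixed_field :: "'a set" where "fixed_field = {x. \<sigma> x = x}"
definition trace :: "'a \<Rightarrow> 'a" where "trace x = x + \<sigma> x"
definition artin_schreier :: "'a set" where "artin_schreier = (\<lambda>x. x * x + x) ` fixed_field"
definition hermitian :: "'a \<Rightarrow> 'a \<Rightarrow> 'a" where "hermitian s t = trace s + t * \<sigma> t"

text \<open>The value \<open>h = 0\<close> is excluded because \<open>inverse 0 = 0\<close> is an element of \<open>artin_schreier\<close>.\<close>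

definition good :: "'a set" where "good = {h \<in> fixed_field. inverse h \<notin> artin_schreier}"

lemma add_self [simp]: "x + x = (0::'a)"
  by (metis char2 mult_2 mult_zero_left)

lemma add_eq_0: "x + y = 0 \<longleftrightarrow> x = (y::'a)"
  by (metis add_self add_left_imp_eq)

lemma add_add_cancel [simp]: "x + (x + y) = (y::'a)"
  by (metis add_self add.assoc add_0)

lemma zero [simp]: "\<sigma> 0 = 0"
  by (metis add add_self)

lemma eq_0_iff [simp]: "\<sigma> x = 0 \<longleftrightarrow> x = 0"
  by (metis invol zero)

lemma one [simp]: "\<sigma> 1 = 1"
  by (metis eq_0_iff mult mult_cancel_right1 zero_neq_one mult_1)

lemma inverse: "\<sigma> (inverse x) = inverse (\<sigma> x)"
  by (metis eq_0_iff inverse_unique inverse_zero mult one right_inverse)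

lemma fixed_add: "x \<in> fixed_field \<Longrightarrow> y \<in> fixed_field \<Longrightarrow> x + y \<in> fixed_field"
  by (simp add: fixed_field_def add)

lemma fixed_mult: "x \<in> fixed_field \<Longrightarrow> y \<in> fixed_field \<Longrightarrow> x * y \<in> fixed_field"
  by (simp add: fixed_field_def mult)

lemma fixed_inverse: "inverse x \<in> fixed_field \<longleftrightarrow> x \<in> fixed_field"
  by (simp add: fixed_field_def inverse)

lemma trace_fixed: "trace x \<in> fixed_field"
  by (simp add: fixed_field_def trace_def add invol add.commute)

lemma norm_fixed: "t * \<sigma> t \<in> fixed_field"
  by (simp add: fixed_field_def mult invol mult.commute)

lemma trace_add: "trace (x + y) = trace x + trace y"
  by (simp add: trace_def add algebra_simps)

lemma trace_eq_0_iff: "trace x = 0 \<longleftrightarrow> x \<in> fixed_field"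
  by (auto simp: trace_def add_eq_0 fixed_field_def)

text \<open>The trace is linear over \<open>fixed_field\<close> and nonzero at some
  \<open>w\<close>, so scaling \<open>w\<close> reaches every fixed element.\<close>

lemma range_trace:
  assumes "\<sigma> \<noteq> id"
  shows "range trace = fixed_field"
proof
  show "range trace \<subseteq> fixed_field"
    using trace_fixed by auto
  obtain w where w: "trace w \<noteq> 0"
    using assms by (auto simp: trace_eq_0_iff fixed_field_def fun_eq_iff)
  have "trace (h * inverse (trace w) * w) = h" if "h \<in> fixed_field" for h
  proof -
    have "\<sigma> (h * inverse (trace w)) = h * inverse (trace w)"
      using fixed_mult[OF that, of "inverse (trace w)"] trace_fixed[of w]
      unfolding fixed_inverse by (simp add: fixed_field_def)
    then have "trace (h * inverse (trace w) * w) = h * inverse (trace w) * trace w"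
      by (simp add: trace_def mult[of "h * _"] distrib_left)
    then show ?thesis using w by simp
  qed
  then show "fixed_field \<subseteq> range trace"
    by (metis rangeI subsetI)
qed

lemma card_trace_fibre:
  assumes "h \<in> range trace"
  shows "card {s. trace s = h} = card fixed_field"
proof -
  obtain r where r: "trace r = h" using assms by auto
  have "bij_betw (\<lambda>x. r + x) fixed_field {s. trace s = h}"
    by (rule bij_betwI[of _ _ _ "\<lambda>x. r + x"])
       (auto simp: r trace_add trace_eq_0_iff[symmetric])
  from bij_betw_same_card[OF this] show ?thesis by simp
qed

lemma artin_schreier_subset: "artin_schreier \<subseteq> fixed_field"
  by (auto simp: artin_schreier_def fixed_add fixed_mult)

lemma zero_fixed: "0 \<in> fixed_field"
  by (simp add: fixed_field_def)

lemma one_fixed: "1 \<in> fixed_field"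
  by (simp add: fixed_field_def)

lemma zero_artin_schreier: "0 \<in> artin_schreier"
  unfolding artin_schreier_def by (rule image_eqI[of _ _ 0]) (auto simp: zero_fixed)

text \<open>In characteristic 2 the map \<open>x * x + x\<close> is additive, as the mixed terms
  cancel.\<close>

lemma artin_schreier_add:
  assumes "x \<in> artin_schreier" "y \<in> artin_schreier"
  shows "x + y \<in> artin_schreier"
proof -
  obtain u v where "u \<in> fixed_field" "v \<in> fixed_field" "x = u * u + u" "y = v * v + v"
    using assms by (auto simp: artin_schreier_def)
  moreover have "(u + v) * (u + v) + (u + v) = (u * u + u) + (v * v + v) + (u * v + u * v)"
    by (simp only: algebra_simps)
  ultimately show ?thesis
    unfolding artin_schreier_def by (intro image_eqI[of _ _ "u + v"]) (auto simp: fixed_add)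
qed

end

section \<open>Counting in a finite field\<close>

locale finite_char2_involution = char2_involution \<sigma> for \<sigma> :: "'a::{field,finite} \<Rightarrow> 'a"
begin

lemma card_UNIV_fixed:
  assumes "\<sigma> \<noteq> id"
  shows "CARD('a) = (card fixed_field)\<^sup>2"
proof -
  have "card (\<Union>h\<in>fixed_field. {s. trace s = h}) = (\<Sum>h\<in>fixed_field. card {s. trace s = h})"
    by (rule card_UN_disjoint) auto
  also have "\<dots> = (card fixed_field)\<^sup>2"
    using card_trace_fibre range_trace[OF assms] by (simp add: power2_eq_square)
  also have "(\<Union>h\<in>fixed_field. {s. trace s = h}) = UNIV"
    using trace_fixed by auto
  finally show ?thesis .
qed

text \<open>The fibres of \<open>x * x + x\<close> on \<open>fixed_field\<close> are the pairs
  \<open>{u, u + 1}\<close>.\<close>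

lemma card_artin_schreier: "2 * card artin_schreier = card fixed_field"
proof -
  have "card {x \<in> fixed_field. x * x + x = h} = 2" if h: "h \<in> artin_schreier" for h
  proof -
    obtain u where u: "u \<in> fixed_field" "h = u * u + u" using h by (auto simp: artin_schreier_def)
    have "x * x + x = u * u + u \<longleftrightarrow> x = u \<or> x = u + 1" for x
    proof -
      have "x * x + x = u * u + u \<longleftrightarrow> (x * x + x) + (u * u + u) = 0"
        by (simp add: add_eq_0)
      \<comment> \<open>The added term \<open>x * u + x * u\<close> is zero and makes the sum
        factor.\<close>
      also have "(x * x + x) + (u * u + u) = (x * x + x) + (u * u + u) + (x * u + x * u)"
        by simp
      also have "\<dots> = (x + u) * (x + (u + 1))"
        by (simp only: algebra_simps mult_1_right mult_1_left)
      also have "\<dots> = 0 \<longleftrightarrow> x = u \<or> x = u + 1" by (simp add: add_eq_0)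
      finally show ?thesis .
    qed
    then have "{x \<in> fixed_field. x * x + x = h} = {u, u + 1}"
      using u one_fixed by (auto simp: fixed_add)
    then show ?thesis by simp
  qed
  then have "card (\<Union>h\<in>artin_schreier. {x \<in> fixed_field. x * x + x = h}) = (\<Sum>h\<in>artin_schreier. 2)"
    by (subst card_UN_disjoint) auto
  moreover have "(\<Union>h\<in>artin_schreier. {x \<in> fixed_field. x * x + x = h}) = fixed_field"
    by (auto simp: artin_schreier_def)
  ultimately show ?thesis by simp
qed

text \<open>By counting, \<open>artin_schreier\<close> and its translate by \<open>x\<close> fill
  \<open>fixed_field\<close>, so \<open>y\<close> lies in the translate.\<close>

lemma artin_schreier_index_two:
  assumes "x \<in> fixed_field" "x \<notin> artin_schreier" "y \<in> fixed_field" "y \<notin> artin_schreier"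
  shows "x + y \<in> artin_schreier"
proof -
  have disj: "artin_schreier \<inter> (\<lambda>z. x + z) ` artin_schreier = {}"
  proof (rule ccontr)
    assume "\<not> ?thesis"
    then obtain z where "z \<in> artin_schreier" "x + z \<in> artin_schreier" by auto
    from artin_schreier_add[OF this] show False using assms
      by (metis add.commute add_add_cancel)
  qed
  have "card (artin_schreier \<union> (\<lambda>z. x + z) ` artin_schreier) =
      card artin_schreier + card ((\<lambda>z. x + z) ` artin_schreier)"
    using disj by (intro card_Un_disjoint) auto
  also have "\<dots> = card fixed_field"
    using card_artin_schreier by (simp add: card_image)
  finally have "artin_schreier \<union> (\<lambda>z. x + z) ` artin_schreier = fixed_field"
    using artin_schreier_subset assms(1) by (intro card_subset_eq) (auto simp: fixed_add)
  then obtain z where "z \<in> artin_schreier" "y = x + z"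
    using assms by auto
  then show ?thesis by simp
qed

lemma card_good: "2 * card good = card fixed_field"
proof -
  have "bij_betw inverse good (fixed_field - artin_schreier)"
    by (rule bij_betwI[of _ _ _ inverse]) (auto simp: good_def fixed_inverse)
  then have "card good = card fixed_field - card artin_schreier"
    by (simp add: bij_betw_same_card card_Diff_subset artin_schreier_subset)
  then show ?thesis using card_artin_schreier by simp
qed

text \<open>For each good value \<open>h\<close> and each \<open>t\<close>, the admissible
  \<open>s\<close> form a fibre of the trace, which has the size of
  \<open>fixed_field\<close>.\<close>

lemma card_hermitian_good:
  assumes "\<sigma> \<noteq> id"
  shows "card {p. hermitian (fst p) (snd p) \<in> good} = (card fixed_field) ^ 4 div 2"
proof -
  have fib: "card ((\<lambda>s. (s, t)) ` {s. trace s = h + t * \<sigma> t}) = card fixed_field"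
    if "h \<in> good" for h t
  proof -
    have "h + t * \<sigma> t \<in> range trace"
      using that by (simp add: range_trace[OF assms] good_def fixed_add norm_fixed)
    then show ?thesis
      by (simp add: card_image inj_on_def card_trace_fibre)
  qed
  have eq: "hermitian s t = h \<longleftrightarrow> trace s = h + t * \<sigma> t" for s t h
    unfolding hermitian_def by (metis add.commute add_add_cancel)
  have "{p. hermitian (fst p) (snd p) \<in> good} =
      (\<Union>p\<in>good \<times> UNIV. (\<lambda>s. (s, snd p)) ` {s. trace s = fst p + snd p * \<sigma> (snd p)})"
    by (force simp: eq[symmetric])
  then have "card {p. hermitian (fst p) (snd p) \<in> good} =
      card (\<Union>p\<in>good \<times> UNIV. (\<lambda>s. (s, snd p)) ` {s. trace s = fst p + snd p * \<sigma> (snd p)})"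
    by (rule arg_cong)
  also have "\<dots> = (\<Sum>p\<in>good \<times> UNIV.
      card ((\<lambda>s. (s, snd p)) ` {s. trace s = fst p + snd p * \<sigma> (snd p)}))"
    by (rule card_UN_disjoint) auto
  also have "\<dots> = (\<Sum>p\<in>good \<times> (UNIV :: 'a set). card fixed_field)"
    by (rule sum.cong) (auto simp: fib)
  also have "\<dots> = card good * (card fixed_field)\<^sup>2 * card fixed_field"
    by (simp add: card_cartesian_product card_UNIV_fixed[OF assms])
  also have "\<dots> = (card fixed_field) ^ 4 div 2"
    unfolding card_good[symmetric] by (simp add: power2_eq_square power4_eq_xxxx)
  finally show ?thesis .
qed

section \<open>Orthogonality for the Hermitian form\<close>

text \<open>The Hermitian form \<open>x * \<sigma> z' + y * \<sigma> y' + z * \<sigma> x'\<close>,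
  restricted to coordinate vectors \<open>(s, t, 1)\<close>.\<close>

definition form :: "'a \<Rightarrow> 'a \<Rightarrow> 'a \<Rightarrow> 'a \<Rightarrow> 'a" where
  "form s t s' t' = s + t * \<sigma> t' + \<sigma> s'"

lemma form_self: "form s t s t = hermitian s t"
  by (simp add: form_def hermitian_def trace_def algebra_simps)

lemma form_sym: "form s t s' t' = 0 \<longleftrightarrow> form s' t' s t = 0"
proof -
  have "\<sigma> (form s t s' t') = form s' t' s t"
    by (simp add: form_def add mult invol algebra_simps)
  then show ?thesis by (metis eq_0_iff)
qed

lemma orthogonal_basis:
  assumes o: "form s1 t1 s2 t2 = 0" "form s1 t1 s3 t3 = 0" "form s2 t2 s3 t3 = 0"
    and n: "hermitian s1 t1 \<noteq> 0" "hermitian s2 t2 \<noteq> 0" "hermitian s3 t3 \<noteq> 0"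
  shows "inverse (hermitian s1 t1) + inverse (hermitian s2 t2) + inverse (hermitian s3 t3) = 0"
proof (rule ccontr)
  \<comment> \<open>\<open>A\<close> is \<open>(1, 0, 0)\<close> and pairs to 1 with every
    \<open>(s, t, 1)\<close>, so these are its coefficients along the three vectors.\<close>
  define c1 c2 c3 where c: "c1 = inverse (hermitian s1 t1)" "c2 = inverse (hermitian s2 t2)"
    "c3 = inverse (hermitian s3 t3)"
  define z where "z = c1 + c2 + c3"
  assume "\<not> ?thesis"
  then have z: "z \<noteq> 0" by (simp add: z_def c)
  \<comment> \<open>\<open>(x, y, z)\<close> is the component of \<open>A\<close> orthogonal to the three vectors; if \<open>z \<noteq> 0\<close>, it must be
    proportional to the third vector, being orthogonal to the first two.\<close>
  define x y where "x = c1 * s1 + c2 * s2 + c3 * s3 + 1" and "y = c1 * t1 + c2 * t2 + c3 * t3"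
  have exp: "x + y * \<sigma> t + z * \<sigma> s = c1 * form s1 t1 s t + c2 * form s2 t2 s t + c3 * form s3 t3 s t + 1"
    for s t by (simp add: x_def y_def z_def form_def algebra_simps)
  have orth: "x + y * \<sigma> t1 + z * \<sigma> s1 = 0" "x + y * \<sigma> t2 + z * \<sigma> s2 = 0" "x + y * \<sigma> t3 + z * \<sigma> s3 = 0"
    unfolding exp using o o[unfolded form_sym[of s1 t1] form_sym[of s2 t2 s3]] n
    by (simp_all add: form_self c)
  show False
  proof (cases "t1 = t2")
    case True
    \<comment> \<open>Both vectors are orthogonal to the third, so equal \<open>t\<close> forces
      equal \<open>s\<close>, and the first vector would be orthogonal to itself.\<close>
    then have "s1 = s2"
      using o by (simp add: form_def) (metis add_right_cancel)
    then show False using True o n form_self by metis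
  next
    case False
    then have ne: "\<sigma> t1 + \<sigma> t2 \<noteq> 0"
      by (metis add eq_0_iff add_eq_0)
    have o': "s3 + t3 * \<sigma> t1 + \<sigma> s1 = 0" "s3 + t3 * \<sigma> t2 + \<sigma> s2 = 0"
      using o[unfolded form_sym[of s1 t1] form_sym[of s2 t2 s3]] by (simp_all add: form_def)
    \<comment> \<open>Adding \<open>z\<close> times the third vector removes the last coordinate and
      preserves orthogonality to the first two.\<close>
    have comb: "(x + z * s3) + (y + z * t3) * \<sigma> t = 0"
      if "x + y * \<sigma> t + z * \<sigma> s = 0" "s3 + t3 * \<sigma> t + \<sigma> s = 0" for s t
    proof -
      have "(x + z * s3) + (y + z * t3) * \<sigma> t = (x + y * \<sigma> t + z * \<sigma> s) +
          z * (s3 + t3 * \<sigma> t + \<sigma> s) + (z * \<sigma> s + z * \<sigma> s)"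
        by (simp only: algebra_simps) (simp add: add.left_commute)
      then show ?thesis unfolding that by simp
    qed
    note e1 = comb[OF orth(1) o'(1)] and e2 = comb[OF orth(2) o'(2)]
    have "(y + z * t3) * (\<sigma> t1 + \<sigma> t2) = 0"
      using e1 e2 by (metis add_eq_0 distrib_left)
    then have "y + z * t3 = 0" using ne by simp
    with e1 have xy: "y = z * t3" "x = z * s3" by (auto simp: add_eq_0)
    \<comment> \<open>The residual vector is now \<open>z\<close> times the third vector, yet
      orthogonal to it.\<close>
    have "z * form s3 t3 s3 t3 = 0"
      using orth(3) by (simp add: xy form_def algebra_simps)
    then show False using z n form_self by simp
  qed
qed

lemma good_no_orthogonal_triple:
  assumes "form s1 t1 s2 t2 = 0" "form s1 t1 s3 t3 = 0" "form s2 t2 s3 t3 = 0"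
    and g: "hermitian s1 t1 \<in> good" "hermitian s2 t2 \<in> good" "hermitian s3 t3 \<in> good"
  shows False
proof -
  have nz: "h \<noteq> 0" if "h \<in> good" for h
    using that zero_artin_schreier by (auto simp: good_def)
  have "inverse (hermitian s1 t1) + inverse (hermitian s2 t2) = inverse (hermitian s3 t3)"
    using orthogonal_basis[OF assms(1-3)] nz g by (simp add: add_eq_0)
  moreover have "inverse (hermitian s1 t1) + inverse (hermitian s2 t2) \<in> artin_schreier"
    using g by (intro artin_schreier_index_two) (auto simp: good_def fixed_inverse)
  ultimately show False using g by (simp add: good_def)
qed

end

subsection \<open>Coordinates for a polarity\<close>

lemma span_singleton_iff: "x \<in> vec.span {v} \<longleftrightarrow> (\<exists>k. x = k *s v)"
  by (auto simp: vec.span_singleton)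

lemma pg_point_span: "v \<noteq> 0 \<Longrightarrow> vec.span {v} \<in> pg_points"
  by (simp add: pg_points_def)

lemma pg_point_obtain:
  assumes "x \<in> pg_points"
  obtains v where "v \<noteq> 0" "x = vec.span {v}"
proof -
  have x: "vec.subspace x" "vec.dim x = 1" using assms by (auto simp: pg_points_def)
  obtain b where b: "b \<subseteq> x" "vec.independent b" "x \<subseteq> vec.span b" "card b = 1"
    using vec.basis_exists[of x] x(2) by metis
  then obtain v where v: "b = {v}" by (auto simp: card_1_singleton_iff)
  have "v \<noteq> 0" using b(2) v by (simp add: vec.dependent_single)
  moreover have "x = vec.span {v}"
    using b x v by (metis subset_antisym vec.span_minimal)
  ultimately show ?thesis using that by blast
qed

lemma span_subset_iff: "vec.subspace L \<Longrightarrow> vec.span {v} \<subseteq> L \<longleftrightarrow> v \<in> L"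
  by (metis insert_subset empty_subsetI vec.span_minimal vec.span_superset subset_trans)

lemma span_eq_UNIV: "vec.dim S = 3 \<Longrightarrow> vec.span S = (UNIV :: ('a::field ^ 3) set)"
  by (simp add: vec.dim_eq_full[symmetric] vec.dimension_def card_cart_basis)

text \<open>A line is a hyperplane of vectors, so it spans the whole space together with any vector
  outside it.\<close>

lemma pg_line_complement:
  assumes "l \<in> pg_lines" "a \<notin> l"
  obtains k where "w + k *s a \<in> l"
proof -
  have l: "vec.subspace l" "vec.dim l = 2" using assms by (auto simp: pg_lines_def)
  then have sl: "vec.span l = l" by simp
  have "vec.dim (insert a l) = 3"
    unfolding vec.dim_insert sl using assms l by simp
  then have "vec.span (insert a l) = UNIV"
    by (rule span_eq_UNIV)
  then have "w \<in> vec.span (insert a l)" by simp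
  then obtain k where "w - k *s a \<in> l"
    using sl by (auto simp: vec.span_insert)
  then have "w + (- k) *s a \<in> l" by simp
  then show ?thesis using that by blast
qed

lemma pg_line_unique:
  assumes "x \<in> pg_points" "y \<in> pg_points" "x \<noteq> y" "l \<in> pg_lines" "m \<in> pg_lines"
    and "x \<subseteq> l" "y \<subseteq> l" "x \<subseteq> m" "y \<subseteq> m"
  shows "l = m"
proof -
  obtain u v where u: "u \<noteq> 0" "x = vec.span {u}" and v: "v \<noteq> 0" "y = vec.span {v}"
    using assms pg_point_obtain by metis
  have sub: "vec.subspace l" "vec.dim l = 2" "vec.subspace m" "vec.dim m = 2"
    using assms by (auto simp: pg_lines_def)
  have "v \<notin> vec.span {u}"
  proof
    assume "v \<in> vec.span {u}"
    then have "y \<subseteq> x" using u v by (metis span_subset_iff vec.subspace_span)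
    moreover have "vec.dim y = vec.dim x" "vec.subspace x" "vec.subspace y"
      using assms by (auto simp: pg_points_def)
    ultimately show False using assms(3) vec.subspace_dim_equal by (metis order_refl)
  qed
  then have d: "vec.dim (vec.span {v, u}) = 2"
    using u by (simp add: vec.dim_insert)
  have "vec.span {v, u} = n" if "vec.subspace n" "vec.dim n = 2" "x \<subseteq> n" "y \<subseteq> n" for n
  proof (rule vec.subspace_dim_equal)
    show "vec.span {v, u} \<subseteq> n"
      using that u v by (intro vec.span_minimal) (auto simp: span_subset_iff)
  qed (use that d in auto)
  then show ?thesis using sub assms by metis
qed

section \<open>Polar lines of points and vectors\<close>

locale plane_polarity =
  fixes perp :: "('a::field ^ 3) set \<Rightarrow> ('a ^ 3) set"
  assumes pol: "pg_polarity perp"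
begin

definition polar :: "'a ^ 3 \<Rightarrow> ('a ^ 3) set" where
  "polar v = perp (vec.span {v})"

lemma perp_line: "x \<in> pg_points \<Longrightarrow> perp x \<in> pg_lines"
  using pol by (auto simp: pg_polarity_def bij_betw_def)

lemma perp_inj: "x \<in> pg_points \<Longrightarrow> y \<in> pg_points \<Longrightarrow> perp x = perp y \<Longrightarrow> x = y"
  using pol by (auto simp: pg_polarity_def bij_betw_def inj_on_def)

lemma perp_sym: "x \<in> pg_points \<Longrightarrow> y \<in> pg_points \<Longrightarrow> x \<subseteq> perp y \<Longrightarrow> y \<subseteq> perp x"
  using polarity_graph_symmetric[OF pol, of x y] by (simp add: polarity_graph_def)

text \<open>Otherwise both polars would join \<open>x\<close> to \<open>y\<close>, hence coincide,
  against injectivity of \<open>perp\<close> on points.\<close>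

lemma absolute_not_adjacent:
  assumes "x \<in> absolute_points perp" "y \<in> absolute_points perp" "x \<noteq> y"
  shows "\<not> x \<subseteq> perp y"
proof
  assume le: "x \<subseteq> perp y"
  have xy: "x \<in> pg_points" "y \<in> pg_points" "x \<subseteq> perp x" "y \<subseteq> perp y"
    using assms by (auto simp: absolute_points_def)
  have "perp x = perp y"
    by (rule pg_line_unique[OF xy(1,2) assms(3) perp_line[OF xy(1)] perp_line[OF xy(2)]
          xy(3) perp_sym[OF xy(1,2) le] le xy(4)])
  then show False using perp_inj xy assms by blast
qed

lemma polar_line: "v \<noteq> 0 \<Longrightarrow> polar v \<in> pg_lines"
  by (simp add: polar_def perp_line pg_point_span)

lemma polar_subspace: "v \<noteq> 0 \<Longrightarrow> vec.subspace (polar v)"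
  using polar_line by (auto simp: pg_lines_def)

lemma span_subset_perp: "v \<noteq> 0 \<Longrightarrow> vec.span {u} \<subseteq> perp (vec.span {v}) \<longleftrightarrow> u \<in> polar v"
  using polar_subspace span_subset_iff by (auto simp: polar_def)

lemma polar_sym: "u \<noteq> 0 \<Longrightarrow> v \<noteq> 0 \<Longrightarrow> u \<in> polar v \<longleftrightarrow> v \<in> polar u"
  by (metis span_subset_perp perp_sym pg_point_span)

lemma polar_add: "v \<noteq> 0 \<Longrightarrow> x \<in> polar v \<Longrightarrow> y \<in> polar v \<Longrightarrow> x + y \<in> polar v"
  using polar_subspace vec.subspace_add by blast

lemma polar_add_iff: "v \<noteq> 0 \<Longrightarrow> x \<in> polar v \<Longrightarrow> x + y \<in> polar v \<longleftrightarrow> y \<in> polar v"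
  using polar_subspace vec.subspace_add vec.subspace_diff by (metis add_diff_cancel_left')

lemma polar_scale: "v \<noteq> 0 \<Longrightarrow> x \<in> polar v \<Longrightarrow> k *s x \<in> polar v"
  using polar_subspace vec.subspace_scale by blast

lemma polar_scale_iff: "v \<noteq> 0 \<Longrightarrow> k \<noteq> 0 \<Longrightarrow> k *s x \<in> polar v \<longleftrightarrow> x \<in> polar v"
  using polar_scale[of v "k *s x" "inverse k"] polar_scale[of v x k]
  by (auto simp: vector_smult_assoc)

end

section \<open>Coordinates from two absolute points\<close>

text \<open>The assumption \<open>unit\<close> fixes the scale of \<open>A\<close>: since
  \<open>vct 0 1\<close> is \<open>C + B\<close>, it yields \<open>\<beta> 1 = 1\<close>.\<close>

locale polar_frame = plane_polarity perp for perp :: "('a::field ^ 3) set \<Rightarrow> ('a ^ 3) set" +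
  fixes A B C :: "'a ^ 3"
  assumes nz: "A \<noteq> 0" "B \<noteq> 0" "C \<noteq> 0"
    and AA: "A \<in> polar A" and BB: "B \<in> polar B" and AB: "A \<notin> polar B"
    and CA: "C \<in> polar A" and CB: "C \<in> polar B"
    and unit: "C + A \<in> polar (C + B)"
begin

lemma BA: "B \<notin> polar A"
  using AB polar_sym nz by blast

text \<open>Membership in \<open>polar A\<close> isolates the coefficient of \<open>B\<close>, and
  membership in \<open>polar B\<close> that of \<open>A\<close>.\<close>

lemma combination_0:
  assumes "x *s A + y *s C + z *s B = 0"
  shows "x = 0 \<and> y = 0 \<and> z = 0"
proof -
  have 0: "0 \<in> polar A" "0 \<in> polar B" using nz polar_subspace vec.subspace_0 by auto
  have "x *s A + y *s C \<in> polar A"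
    using nz AA CA by (intro polar_add polar_scale)
  then have "z *s B \<in> polar A" using 0 assms nz polar_add_iff by metis
  then have z: "z = 0" using polar_scale_iff BA nz by blast
  have "y *s C + x *s A = 0" using assms z by (simp add: add.commute)
  moreover have "y *s C \<in> polar B" using nz CB by (intro polar_scale)
  ultimately have "x *s A \<in> polar B" using 0 nz polar_add_iff by metis
  then have x: "x = 0" using polar_scale_iff AB nz by blast
  then show ?thesis using assms z nz by (simp add: vec.scale_eq_0_iff)
qed

lemma spanning:
  obtains x y z where "u = x *s A + y *s C + z *s B"
proof -
  have "A \<notin> vec.span {}" using nz by simp
  moreover have "C \<notin> vec.span {A}"
  proof
    assume "C \<in> vec.span {A}"
    then obtain k where "C = k *s A" by (auto simp: span_singleton_iff)
    then show False using combination_0[of k "-1" 0] by simp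
  qed
  moreover have "B \<notin> vec.span {C, A}"
  proof
    have "vec.span {C, A} \<subseteq> polar A"
      using AA CA nz polar_subspace by (intro vec.span_minimal) auto
    moreover assume "B \<in> vec.span {C, A}"
    ultimately show False using BA by auto
  qed
  ultimately have "vec.dim {B, C, A} = 3"
    by (simp add: vec.dim_insert)
  then have "vec.span {B, C, A} = UNIV"
    by (rule span_eq_UNIV)
  then have "u \<in> vec.span {B, C, A}" by simp
  then obtain z y x where "u - z *s B - y *s C = x *s A"
    by (auto simp: vec.span_insert)
  then have "u = x *s A + y *s C + z *s B" by (simp add: algebra_simps)
  then show ?thesis using that by blast
qed

definition vct :: "'a \<Rightarrow> 'a \<Rightarrow> 'a ^ 3" where "vct s t = s *s A + t *s C + B"
definition pnt :: "'a \<Rightarrow> 'a \<Rightarrow> ('a ^ 3) set" where "pnt s t = vec.span {vct s t}"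

lemma vct_nz: "vct s t \<noteq> 0"
  using combination_0[of s t 1] by (auto simp: vct_def)

lemma A_notin_polar_vct: "A \<notin> polar (vct s t)"
proof -
  have "s *s A + t *s C \<in> polar A"
    using nz AA CA by (intro polar_add polar_scale)
  then have "vct s t \<notin> polar A"
    unfolding vct_def using polar_add_iff nz BA by blast
  then show ?thesis using polar_sym nz vct_nz by blast
qed

text \<open>As \<open>A\<close> is off this polar, each vector is a unique multiple of
  \<open>A\<close> modulo it; the assumptions fix the multiples for \<open>C\<close> and
  \<open>B\<close>.\<close>

lemma polar_vct_coordinates:
  assumes "C + m *s A \<in> polar (vct s t)" "B + k *s A \<in> polar (vct s t)"
  shows "x *s A + y *s C + z *s B \<in> polar (vct s t) \<longleftrightarrow> x = m * y + k * z"
proof -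
  have "y *s (C + m *s A) + z *s (B + k *s A) \<in> polar (vct s t)"
    by (intro polar_add[OF vct_nz] polar_scale[OF vct_nz, OF assms(1)]
        polar_scale[OF vct_nz, OF assms(2)])
  moreover have "x *s A + y *s C + z *s B =
      (y *s (C + m *s A) + z *s (B + k *s A)) + (x - (m * y + k * z)) *s A"
    by (simp add: vec_eq_iff algebra_simps)
  ultimately have "x *s A + y *s C + z *s B \<in> polar (vct s t) \<longleftrightarrow>
      (x - (m * y + k * z)) *s A \<in> polar (vct s t)"
    using polar_add_iff[OF vct_nz] by simp
  also have "\<dots> \<longleftrightarrow> x - (m * y + k * z) = 0"
    using polar_scale_iff[OF vct_nz] A_notin_polar_vct
    by (metis polar_subspace vct_nz vec.subspace_0 vector_smult_lzero)
  finally show ?thesis by simp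
qed

definition \<beta> :: "'a \<Rightarrow> 'a" where "\<beta> t = (SOME m. C + m *s A \<in> polar (vct 0 t))"
definition \<alpha> :: "'a \<Rightarrow> 'a" where "\<alpha> s = (SOME k. B + k *s A \<in> polar (vct s 0))"

text \<open>The polar of \<open>C + \<beta> t *s A\<close> contains \<open>A\<close> and
  \<open>vct 0 t\<close>, hence every \<open>vct s t\<close>, so the choice made at
  \<open>s = 0\<close> serves all \<open>s\<close>.\<close>

lemma \<beta>: "C + \<beta> t *s A \<in> polar (vct s t)"
proof -
  have mem: "C + \<beta> t *s A \<in> polar (vct 0 t)"
    unfolding \<beta>_def
    by (rule someI_ex) (meson pg_line_complement polar_line vct_nz A_notin_polar_vct)
  have ne: "C + \<beta> t *s A \<noteq> 0" using combination_0[of "\<beta> t" 1 0] by (auto simp: add.commute)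
  have "C + \<beta> t *s A \<in> polar A" using nz AA CA by (intro polar_add polar_scale)
  then have A: "A \<in> polar (C + \<beta> t *s A)" using polar_sym ne nz by blast
  have "vct 0 t \<in> polar (C + \<beta> t *s A)" using mem polar_sym ne vct_nz by blast
  then have "s *s A + vct 0 t \<in> polar (C + \<beta> t *s A)"
    using A ne by (intro polar_add polar_scale)
  then have "vct s t \<in> polar (C + \<beta> t *s A)" by (simp add: vct_def algebra_simps)
  then show ?thesis using polar_sym ne vct_nz by blast
qed

text \<open>The same concurrence with \<open>C\<close> in the role of \<open>A\<close>: the polar of
  \<open>B + \<alpha> s *s A\<close> contains \<open>C\<close> and \<open>vct s 0\<close>.\<close>

lemma \<alpha>: "B + \<alpha> s *s A \<in> polar (vct s t)"
proof -
  have mem: "B + \<alpha> s *s A \<in> polar (vct s 0)"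
    unfolding \<alpha>_def
    by (rule someI_ex) (meson pg_line_complement polar_line vct_nz A_notin_polar_vct)
  have ne: "B + \<alpha> s *s A \<noteq> 0" using combination_0[of "\<alpha> s" 0 1] by (auto simp: add.commute)
  have "B \<in> polar C" "A \<in> polar C" using polar_sym nz CA CB by blast+
  then have "B + \<alpha> s *s A \<in> polar C" using nz by (intro polar_add polar_scale)
  then have C: "C \<in> polar (B + \<alpha> s *s A)" using polar_sym ne nz by blast
  have "vct s 0 \<in> polar (B + \<alpha> s *s A)" using mem polar_sym ne vct_nz by blast
  then have "t *s C + vct s 0 \<in> polar (B + \<alpha> s *s A)"
    using C ne by (intro polar_add polar_scale)
  then have "vct s t \<in> polar (B + \<alpha> s *s A)" by (simp add: vct_def algebra_simps)
  then show ?thesis using polar_sym ne vct_nz by blast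
qed

lemmas polar_vct_iff = polar_vct_coordinates[OF \<beta> \<alpha>]

lemma vct_polar_vct: "vct x y \<in> polar (vct s t) \<longleftrightarrow> x = \<beta> t * y + \<alpha> s"
  using polar_vct_iff[of x y 1 s t] by (simp add: vct_def)

lemma vct_polar_vct': "vct x y \<in> polar (vct s t) \<longleftrightarrow> s = \<beta> y * t + \<alpha> x"
  using vct_polar_vct polar_sym vct_nz by metis

lemma \<beta>_0: "\<beta> 0 = 0" and \<alpha>_0: "\<alpha> 0 = 0" and \<beta>_1: "\<beta> 1 = 1"
proof -
  show "\<beta> 0 = 0"
    using polar_vct_iff[of 0 1 0 0 0] CB by (simp add: vct_def)
  show "\<alpha> 0 = 0"
    using polar_vct_iff[of 0 0 1 0 0] BB by (simp add: vct_def)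
  show "\<beta> 1 = 1"
    using polar_vct_iff[of 1 1 0 0 1] unit by (simp add: vct_def add.commute)
qed

text \<open>Conjugacy is symmetric, so it can be solved for \<open>x\<close> or for
  \<open>s\<close>; eliminating \<open>x\<close> gives this functional equation.\<close>

lemma \<alpha>_\<beta>: "\<alpha> (\<beta> t * y + \<alpha> s) = s - \<beta> y * t"
  using vct_polar_vct[of "\<beta> t * y + \<alpha> s" y s t] vct_polar_vct'[of "\<beta> t * y + \<alpha> s" y s t]
  by (simp add: algebra_simps)

text \<open>Every law is an instance of \<open>\<alpha>_\<beta>\<close> with signs dropped:
  \<open>t = y = 0\<close> gives the involution, \<open>t = 1\<close> and \<open>s = 0\<close> give
  \<open>\<alpha> = \<beta>\<close>, \<open>t = 1\<close> gives additivity, and \<open>s = 0\<close>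
  multiplicativity.\<close>

lemma involution:
  assumes "(2::'a) = 0"
  shows "char2_involution \<alpha>" "\<alpha> = \<beta>"
proof -
  have dbl: "x + x = (0::'a)" for x using assms by (metis mult_2 mult_zero_left)
  then have minus: "x - y = x + y" for x y :: 'a by (metis add_diff_cancel add.assoc add.right_neutral)
  have inv: "\<alpha> (\<alpha> s) = s" for s using \<alpha>_\<beta>[of 0 0 s] by (simp add: \<beta>_0)
  show eq: "\<alpha> = \<beta>"
    using \<alpha>_\<beta>[of 1 _ 0] by (auto simp: \<beta>_1 \<alpha>_0 minus simp del: diff_0)
  have one: "\<alpha> 1 = 1" using \<beta>_1 eq by simp
  show "char2_involution \<alpha>"
  proof
    show "(2::'a) = 0" by fact
    show "\<alpha> (x + y) = \<alpha> x + \<alpha> y" for x y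
      using \<alpha>_\<beta>[of 1 x "\<alpha> y"] by (simp add: one inv minus eq[symmetric] add.commute)
    show "\<alpha> (x * y) = \<alpha> x * \<alpha> y" for x y
      using \<alpha>_\<beta>[of "\<alpha> x" y 0] by (simp add: \<alpha>_0 inv minus eq[symmetric] mult.commute del: diff_0)
    show "\<alpha> (\<alpha> x) = x" for x by (rule inv)
  qed
qed

lemma pnt_point: "pnt s t \<in> pg_points"
  by (simp add: pnt_def pg_point_span vct_nz)

lemma pnt_eq_iff: "pnt s t = pnt s' t' \<longleftrightarrow> s = s' \<and> t = t'"
proof
  assume "pnt s t = pnt s' t'"
  then have "vct s t \<in> vec.span {vct s' t'}"
    unfolding pnt_def by (metis vec.span_base singletonI)
  then obtain k where "vct s t = k *s vct s' t'" by (auto simp: span_singleton_iff)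
  then have "(s - k * s') *s A + (t - k * t') *s C + (1 - k) *s B = 0"
    by (simp add: vct_def vec_eq_iff algebra_simps)
  from combination_0[OF this] show "s = s' \<and> t = t'" by auto
qed auto

lemma pnt_subset_perp: "pnt x y \<subseteq> perp (pnt s t) \<longleftrightarrow> x = \<beta> t * y + \<alpha> s"
  unfolding pnt_def by (simp add: span_subset_perp vct_nz vct_polar_vct)

text \<open>Distinct absolute points are never conjugate, so \<open>A\<close> spans the only one on
  its polar; points off that polar have the form \<open>pnt s t\<close>.\<close>

lemma absolute_points_eq:
  "absolute_points perp = insert (vec.span {A}) {pnt s t |s t. s = \<beta> t * t + \<alpha> s}" (is "_ = ?R")
proof
  have abs_A: "vec.span {A} \<in> absolute_points perp"
    using AA nz by (simp add: absolute_points_def pg_point_span span_subset_perp)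
  have abs_pnt: "pnt s t \<in> absolute_points perp \<longleftrightarrow> s = \<beta> t * t + \<alpha> s" for s t
    by (simp add: absolute_points_def pnt_point pnt_subset_perp)
  with abs_A show "?R \<subseteq> absolute_points perp" by auto
  show "absolute_points perp \<subseteq> ?R"
  proof
    fix p assume p: "p \<in> absolute_points perp"
    then obtain u where u: "u \<noteq> 0" "p = vec.span {u}"
      by (auto simp: absolute_points_def elim: pg_point_obtain)
    obtain x y z where xyz: "u = x *s A + y *s C + z *s B" by (rule spanning)
    show "p \<in> ?R"
    proof (cases "z = 0")
      case True
      have "u \<in> polar A"
        using nz AA CA True unfolding xyz by (simp add: polar_add polar_scale)
      then have "p \<subseteq> perp (vec.span {A})" using nz u by (simp add: span_subset_perp)
      then show ?thesis using absolute_not_adjacent p abs_A by blast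
    next
      case False
      then have "u = z *s vct (x / z) (y / z)"
        by (simp add: xyz vct_def vec_eq_iff field_simps)
      then have "p = pnt (x / z) (y / z)"
        using False by (simp add: u pnt_def vec.span_image_scale[of "{_}" "\<lambda>_. z", simplified])
      then show ?thesis using p abs_pnt by blast
    qed
  qed
qed

lemma A_not_pnt: "vec.span {A} \<noteq> pnt s t"
proof
  assume "vec.span {A} = pnt s t"
  then have "A \<in> vec.span {vct s t}" unfolding pnt_def by (metis vec.span_base singletonI)
  then obtain k where "A = k *s vct s t" by (auto simp: span_singleton_iff)
  then have "(k * s - 1) *s A + (k * t) *s C + k *s B = 0"
    by (simp add: vct_def vec_eq_iff algebra_simps)
  from combination_0[OF this] show False by auto
qed

end

section \<open>Existence of a normalised frame\<close>

lemma (in plane_polarity) polar_frame_exists: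
  assumes "a \<in> absolute_points perp" "b \<in> absolute_points perp" "a \<noteq> b"
  shows "\<exists>A B C. polar_frame perp A B C"
proof -
  obtain A\<^sub>0 B where A: "A\<^sub>0 \<noteq> 0" "a = vec.span {A\<^sub>0}" and B: "B \<noteq> 0" "b = vec.span {B}"
    using assms by (metis (no_types, lifting) absolute_points_def mem_Collect_eq pg_point_obtain)
  have AA: "A\<^sub>0 \<in> polar A\<^sub>0" and BB: "B \<in> polar B"
    using assms A B span_subset_perp by (auto simp: absolute_points_def)
  have AB: "A\<^sub>0 \<notin> polar B"
    using absolute_not_adjacent[OF assms] A B span_subset_perp by auto
  then have BA: "B \<notin> polar A\<^sub>0" using polar_sym A B by blast
  \<comment> \<open>For dimension reasons the polar contains some \<open>D\<close> independent of
    \<open>A\<^sub>0\<close>; moving \<open>D\<close> along \<open>A\<^sub>0\<close> into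
    \<open>polar B\<close> then yields \<open>C\<close>.\<close>
  have "\<not> polar A\<^sub>0 \<subseteq> vec.span {A\<^sub>0}"
  proof
    assume "polar A\<^sub>0 \<subseteq> vec.span {A\<^sub>0}"
    then have "vec.dim (polar A\<^sub>0) \<le> vec.dim {A\<^sub>0}" by (metis vec.dim_subset vec.dim_span)
    then show False using polar_line[OF A(1)] A by (simp add: pg_lines_def)
  qed
  then obtain D where D: "D \<in> polar A\<^sub>0" "D \<notin> vec.span {A\<^sub>0}" by auto
  obtain k where k: "D + k *s A\<^sub>0 \<in> polar B"
    using pg_line_complement[OF polar_line[OF B(1)] AB] .
  define C where "C = D + k *s A\<^sub>0"
  have CB: "C \<in> polar B" using k by (simp add: C_def)
  have CA: "C \<in> polar A\<^sub>0" using A D AA by (simp add: C_def polar_add polar_scale)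
  have C: "C \<noteq> 0"
  proof
    assume "C = 0"
    then have "D = (- k) *s A\<^sub>0" by (simp add: C_def add_eq_0_iff2)
    then show False using D span_singleton_iff by blast
  qed
  have CB_A: "C + B \<notin> polar A\<^sub>0" using BA CA A polar_add_iff by blast
  have CBnz: "C + B \<noteq> 0"
    using CB_A A polar_subspace vec.subspace_0 by metis
  have nA: "A\<^sub>0 \<notin> polar (C + B)" using CB_A CBnz A polar_sym by blast
  \<comment> \<open>For the unscaled \<open>A\<^sub>0\<close>, \<open>e\<close> would be the value
    of \<open>\<beta>\<close> at 1; if it is nonzero, replacing \<open>A\<^sub>0\<close> by
    \<open>e *s A\<^sub>0\<close> turns it into 1.\<close>
  obtain e where e: "C + e *s A\<^sub>0 \<in> polar (C + B)"
    using pg_line_complement[OF polar_line[OF CBnz] nA] .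
  \<comment> \<open>An absolute point on both polars would have to equal both \<open>a\<close> and
    \<open>b\<close>.\<close>
  have "C \<notin> polar C"
  proof
    assume "C \<in> polar C"
    then have p: "vec.span {C} \<in> absolute_points perp"
      using C by (simp add: absolute_points_def pg_point_span span_subset_perp)
    have "vec.span {C} \<subseteq> perp a" "vec.span {C} \<subseteq> perp b"
      using A B CA CB span_subset_perp by auto
    then have "vec.span {C} = a" "vec.span {C} = b"
      using absolute_not_adjacent p assms by blast+
    then show False using assms by simp
  qed
  moreover have "B \<in> polar C" using CB polar_sym B C by blast
  ultimately have "C + B \<notin> polar C" using C polar_add_iff by (metis add.commute)
  then have "C \<notin> polar (C + B)" using C CBnz polar_sym by blast
  then have e0: "e \<noteq> 0" using e by auto
  have pe: "polar (e *s A\<^sub>0) = polar A\<^sub>0"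
    unfolding polar_def using e0 vec.span_image_scale[of "{A\<^sub>0}" "\<lambda>_. e"] by simp
  have "polar_frame perp (e *s A\<^sub>0) B C"
    by unfold_locales
       (use A B C e0 e AA AB BB CA CB in \<open>auto simp: pe polar_scale polar_scale_iff vec.scale_eq_0_iff\<close>)
  then show ?thesis by blast
qed

lemma char2_of_even_order:
  assumes "primepow q" "even q" "CARD('a::{field,finite}) = q ^ 2"
  shows "(2::'a) = 0"
proof -
  obtain p k where pk: "prime p" "q = p ^ k" using assms(1) by (auto simp: primepow_def)
  then have "p = 2"
    using assms(2) by (metis prime_dvd_power primes_dvd_imp_eq two_is_prime_nat)
  then have "CARD('a) = 2 ^ (k * 2)" using pk assms(3) by (simp add: power_mult)
  moreover have "of_nat CARD('a) = (0::'a)"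
  proof -
    \<comment> \<open>Translation by 1 permutes the field, so the ones contributed by all elements
      sum to 0.\<close>
    have "(\<Sum>x\<in>UNIV. x + 1) = (\<Sum>x\<in>(UNIV::'a set). x)"
      by (rule sum.reindex_bij_witness[of _ "\<lambda>x. x - 1" "\<lambda>x. x + 1"]) auto
    then show ?thesis by (simp add: sum.distrib)
  qed
  ultimately show ?thesis by simp
qed

theorem theorem2:
  fixes q :: nat
    and perp :: "('a::{field,finite} ^ 3) set \<Rightarrow> ('a ^ 3) set"
  assumes "primepow q" and "even q"
    and "CARD('a) = q ^ 2"
    and "unitary_polarity q perp"
  shows "\<exists>S. S \<subseteq> pg_points - absolute_points perp \<and> card S = q ^ 4 div 2 \<and>
             triangle_free (with_proj (polarity_graph perp) \<restriction> S)"
proof -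
  have pol: "pg_polarity perp" and card_abs: "card (absolute_points perp) = q ^ 3 + 1"
    using assms(4) by (auto simp: unitary_polarity_def)
  interpret plane_polarity perp by unfold_locales (rule pol)
  have q: "q > 1" using assms(1) by (rule primepow_gt_Suc_0[unfolded One_nat_def[symmetric]])
  have "\<exists>a\<in>absolute_points perp. \<exists>b\<in>absolute_points perp. a \<noteq> b"
  proof (rule ccontr)
    assume "\<not> ?thesis"
    then have "card (absolute_points perp) \<le> Suc 0"
      by (intro card_le_Suc0_iff_eq[THEN iffD2]) auto
    then show False using card_abs q by simp
  qed
  then obtain A B C where "polar_frame perp A B C" using polar_frame_exists by blast
  then interpret polar_frame perp A B C .
  note char2 = char2_of_even_order[OF assms(1-3)]
  interpret finite_char2_involution \<alpha>
    by (simp add: finite_char2_involution_def involution(1) char2)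
  have \<beta>_eq: "\<beta> = \<alpha>" using involution(2)[OF char2] by simp
  have adj: "pnt s t \<subseteq> perp (pnt s' t') \<longleftrightarrow> form s t s' t' = 0" for s t s' t'
    unfolding pnt_subset_perp \<beta>_eq form_def
    by (simp add: add.assoc add_eq_0 mult.commute)
  have abs: "pnt s t \<in> absolute_points perp \<longleftrightarrow> hermitian s t = 0" for s t
    by (simp add: absolute_points_def pnt_point adj form_self)
  \<comment> \<open>For the identity, \<open>pnt s t\<close> is absolute iff \<open>t = 0\<close>,
    which would leave only \<open>q ^ 2 + 1\<close> absolute points.\<close>
  have not_id: "\<alpha> \<noteq> id"
  proof
    assume id: "\<alpha> = id"
    have "s = \<beta> t * t + \<alpha> s \<longleftrightarrow> t = 0" for s t by (simp add: \<beta>_eq id)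
    then have "absolute_points perp = insert (vec.span {A}) (range (\<lambda>s. pnt s 0))"
      unfolding absolute_points_eq by auto
    moreover have "card (range (\<lambda>s. pnt s 0)) = CARD('a)"
      by (simp add: card_image inj_on_def pnt_eq_iff)
    moreover have "vec.span {A} \<notin> range (\<lambda>s. pnt s 0)" using A_not_pnt by auto
    ultimately have "q ^ 3 = q ^ 2" using card_abs assms(3) by simp
    then show False using q by (simp add: power_inject_exp)
  qed
  have card_F: "card fixed_field = q"
    using card_UNIV_fixed[OF not_id] assms(3) by simp
  define S where "S = (\<lambda>p. pnt (fst p) (snd p)) ` {p. hermitian (fst p) (snd p) \<in> good}"
  have "S \<subseteq> pg_points - absolute_points perp"
    using zero_artin_schreier by (auto simp: S_def pnt_point abs good_def)
  moreover have "card S = q ^ 4 div 2"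
    using card_hermitian_good[OF not_id]
    by (simp add: S_def card_image inj_on_def pnt_eq_iff prod_eq_iff card_F)
  moreover have "triangle_free (with_proj (polarity_graph perp) \<restriction> S)"
    unfolding triangle_free_def
  proof
    assume "\<exists>T. triangle_in (with_proj (polarity_graph perp) \<restriction> S) T"
    then obtain T where T: "T \<subseteq> S" "card T = 3"
      and arcs: "\<And>x y. x \<in> T \<Longrightarrow> y \<in> T \<Longrightarrow> x \<noteq> y \<Longrightarrow> x \<subseteq> perp y"
      by (auto simp: triangle_in_def arcs_ends_def arc_to_ends_def polarity_graph_def)
    obtain x y z where xyz: "T = {x, y, z}" "x \<noteq> y" "x \<noteq> z" "y \<noteq> z"
      using T(2) by (auto simp: card_3_iff)
    obtain s1 t1 where "x = pnt s1 t1" "hermitian s1 t1 \<in> good"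
      using T(1) xyz by (auto simp: S_def)
    moreover obtain s2 t2 where "y = pnt s2 t2" "hermitian s2 t2 \<in> good"
      using T(1) xyz by (auto simp: S_def)
    moreover obtain s3 t3 where "z = pnt s3 t3" "hermitian s3 t3 \<in> good"
      using T(1) xyz by (auto simp: S_def)
    moreover have "x \<subseteq> perp y" "x \<subseteq> perp z" "y \<subseteq> perp z"
      using arcs xyz by auto
    ultimately show False using good_no_orthogonal_triple adj by simp
  qed
  ultimately show ?thesis by blast
qed

end
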